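(* The typical (expected) maximal effective row $r$ of a switch table for a sequence of $k$ permutations of degree $n$ chosen uniformly and independently at random with replacement from $\mathrm{Sym}(n)$ is at most $1+\frac{2k}{n}$. In particular, whenever the degree is at least twice the order, i.e. $n\ge 2k$, the typical maximal effective row $r$ is at most two.
   Context: For a sequence $G$ of permutations of $\{1,\dots,n\}$, the entry in row $i$ and column $j$ of a switch table for $G$ is non-trivial if and only if $j>i$ and there is a $\pi$ in $G$ with $\pi(t)=t$ for all $t<i$ and $\pi(j)=i$. Row $i$ is effective if it contains a non-trivial entry, and $r$ is the largest index of an effective row. The expected value is $\mathbb{E}[r]=\sum_{i=1}^{n} i\cdot\mathbb{P}(r=i)$ (sequences without any effective row contribute $0$). *)

theory Defs
  imports "HOL-Probability.Probability" "HOL-Combinatorics.Permutations"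
begin

text \<open>A permutation of degree \<open>n\<close> is a function \<open>nat \<Rightarrow> nat\<close> that \<open>permutes {1..n}\<close>; in particular it
  is the identity outside \<open>{1..n}\<close>, so such functions correspond one-to-one to the elements
  of \<open>Sym(n)\<close>. The entries of a switch table are not determined by the sequence in general,
  but which of them are non-trivial is, and only this matters below.\<close>

definition nontrivial_entry :: "nat \<Rightarrow> (nat \<Rightarrow> nat) list \<Rightarrow> nat \<Rightarrow> nat \<Rightarrow> bool" where
  "nontrivial_entry n G i j \<longleftrightarrow>
     i \<in> {1..n} \<and> j \<in> {1..n} \<and> j > i \<and> (\<exists>\<pi>\<in>set G. (\<forall>t\<in>{1..<i}. \<pi> t = t) \<and> \<pi> j = i)"

definition effective_rows :: "nat \<Rightarrow> (nat \<Rightarrow> nat) list \<Rightarrow> nat set" where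
  "effective_rows n G = {i \<in> {1..n}. \<exists>j\<in>{1..n}. nontrivial_entry n G i j}"

text \<open>Rows are numbered from \<open>1\<close>, so the value \<open>0\<close> in the absence of effective rows is
  unambiguous and makes such sequences contribute \<open>0\<close> to the expectation.\<close>

definition max_effective_row :: "nat \<Rightarrow> (nat \<Rightarrow> nat) list \<Rightarrow> nat" where
  "max_effective_row n G = (if effective_rows n G = {} then 0 else Max (effective_rows n G))"

definition random_perm_seq :: "nat \<Rightarrow> nat \<Rightarrow> (nat \<Rightarrow> nat) list pmf" where
  "random_perm_seq n k = replicate_pmf k (pmf_of_set {\<pi>. \<pi> permutes {1..n}})"

definition expected_max_effective_row :: "nat \<Rightarrow> nat \<Rightarrow> real" where
  "expected_max_effective_row n k =
     measure_pmf.expectation (random_perm_seq n k) (\<lambda>G. real (max_effective_row n G))"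

lemma max_effective_row_le: "max_effective_row n G \<le> n"
proof (cases "effective_rows n G = {}")
  case False
  have "finite (effective_rows n G)" by (simp add: effective_rows_def)
  with False have "Max (effective_rows n G) \<in> effective_rows n G" by simp
  with False show ?thesis by (simp add: max_effective_row_def effective_rows_def)
qed (simp add: max_effective_row_def)

lemma expected_max_effective_row_eq_sum:
  "expected_max_effective_row n k =
     (\<Sum>i=1..n. real i * measure_pmf.prob (random_perm_seq n k) {G. max_effective_row n G = i})"
proof -
  let ?p = "map_pmf (max_effective_row n) (random_perm_seq n k)"
  have "expected_max_effective_row n k = measure_pmf.expectation ?p real"
    by (simp add: expected_max_effective_row_def)
  also have "\<dots> = (\<Sum>i\<in>{0..n}. real i * pmf ?p i)"
    by (subst integral_measure_pmf_real[of "{0..n}"]) (auto simp: max_effective_row_le)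
  also have "\<dots> = (\<Sum>i=1..n. real i * pmf ?p i)"
    by (rule sum.mono_neutral_right) auto
  finally show ?thesis by (simp add: pmf_map vimage_def)
qed

lemma pmf_random_perm_seq:
  "pmf (random_perm_seq n k) G =
     (if length G = k \<and> (\<forall>\<pi>\<in>set G. \<pi> permutes {1..n}) then 1 / fact n ^ k else 0)"
proof (induction k arbitrary: G)
  case 0
  then show ?case by (auto simp: random_perm_seq_def)
next
  case (Suc k)
  let ?P = "{\<pi>. \<pi> permutes {1..n}}"
  have fin: "finite ?P" by (rule finite_permutations) simp
  have ne: "?P \<noteq> {}" using permutes_id by blast
  have c: "card ?P = fact n" by (rule card_permutations) auto
  have eq: "random_perm_seq n (Suc k) =
      map_pmf (\<lambda>(x, xs). x # xs) (pair_pmf (pmf_of_set ?P) (random_perm_seq n k))"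
    by (simp add: random_perm_seq_def pair_pmf_def map_bind_pmf)
  have inj: "inj (\<lambda>(x :: nat \<Rightarrow> nat, xs). x # xs)" by (auto simp: inj_def)
  show ?case
  proof (cases G)
    case Nil
    then show ?thesis by (auto simp: eq set_pmf_iff[symmetric] pmf_eq_0_set_pmf)
  next
    case (Cons x xs)
    have "pmf (random_perm_seq n (Suc k)) G =
        pmf (pair_pmf (pmf_of_set ?P) (random_perm_seq n k)) (x, xs)"
      unfolding eq using pmf_map_inj'[OF inj, of _ "(x, xs)"] Cons by simp
    then show ?thesis
      using fin ne c by (auto simp: pmf_pair Suc.IH Cons indicator_def)
  qed
qed

end

theory Submission
  imports Defs
begin

text \<open>Row \<open>i\<close> is effective only if some member of the sequence fixes all points below \<open>i\<close>. Hence
  \<open>r\<close> exceeds \<open>1\<close> by at most the number of pairs \<open>(\<pi>, i)\<close>, with \<open>\<pi>\<close> in the sequence and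
  \<open>2 \<le> i \<le> n\<close>, such that \<open>\<pi>\<close> fixes \<open>1, \<dots>, i - 1\<close>. One uniform \<open>\<pi>\<close> does so with probability
  \<open>(n - i + 1)! / n!\<close>, and summing the factorials costs at most twice the largest one, \<open>(n - 1)!\<close>.\<close>

text \<open>The index 1 is left out because its condition is vacuous: every permutation would be
  counted there. The summand 1 in the bound below takes its place.\<close>

definition fixed_prefixes :: "nat \<Rightarrow> (nat \<Rightarrow> nat) \<Rightarrow> nat set" where
  "fixed_prefixes n \<pi> = {i \<in> {2..n}. \<forall>t\<in>{1..<i}. \<pi> t = t}"

text \<open>A permutation that makes row \<open>r\<close> effective fixes every shorter prefix as
  well, so it alone contributes all of \<open>{2..r}\<close>, that is \<open>r - 1\<close>
  indices.\<close>

lemma max_effective_row_le_sum_list: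
  "max_effective_row n G \<le> 1 + (\<Sum>\<pi>\<leftarrow>G. card (fixed_prefixes n \<pi>))"
proof (cases "effective_rows n G = {}")
  case False
  define r where "r = Max (effective_rows n G)"
  have "finite (effective_rows n G)" by (simp add: effective_rows_def)
  with False have "r \<in> effective_rows n G" by (simp add: r_def)
  then obtain \<pi> where \<pi>: "\<pi> \<in> set G" "\<forall>t\<in>{1..<r}. \<pi> t = t" and "r \<le> n"
    by (auto simp: effective_rows_def nontrivial_entry_def)
  then have "{2..r} \<subseteq> fixed_prefixes n \<pi>" by (auto simp: fixed_prefixes_def)
  then have "card {2..r} \<le> card (fixed_prefixes n \<pi>)"
    by (intro card_mono) (auto simp: fixed_prefixes_def)
  also have "\<dots> \<le> (\<Sum>\<pi>\<leftarrow>G. card (fixed_prefixes n \<pi>))"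
    using \<pi>(1) by (intro member_le_sum_list) auto
  finally have "r - 1 \<le> (\<Sum>\<pi>\<leftarrow>G. card (fixed_prefixes n \<pi>))" by simp
  with False show ?thesis by (simp add: max_effective_row_def r_def)
qed (simp add: max_effective_row_def)

text \<open>Finite support makes every real function of the random list integrable, as monotonicity
  and additivity of the expectation require.\<close>

lemma finite_set_replicate_pmf:
  assumes "finite (set_pmf p)"
  shows "finite (set_pmf (replicate_pmf k p))"
  using assms finite_lists_length_eq[of "set_pmf p" k]
  by (simp add: set_replicate_pmf lists_eq_set conj_commute subset_iff)

text \<open>Linearity of expectation, by induction on \<open>k\<close>: given the head
  \<open>x\<close>, the sum is \<open>g x\<close> plus the sum over a tail distributed as
  \<open>replicate_pmf k p\<close>.\<close>

lemma expectation_sum_list_replicate_pmf: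
  fixes g :: "'a \<Rightarrow> real"
  assumes fin: "finite (set_pmf p)"
  shows "measure_pmf.expectation (replicate_pmf k p) (\<lambda>xs. \<Sum>x\<leftarrow>xs. g x)
           = real k * measure_pmf.expectation p g"
proof (induction k)
  case (Suc k)
  let ?q = "replicate_pmf k p"
  have int: "integrable (measure_pmf ?q) f" for f :: "'a list \<Rightarrow> real"
    using finite_set_replicate_pmf[OF fin] by (rule integrable_measure_pmf_finite)
  have "replicate_pmf (Suc k) p = p \<bind> (\<lambda>x. map_pmf ((#) x) ?q)"
    by (simp add: map_pmf_def)
  then have "measure_pmf.expectation (replicate_pmf (Suc k) p) (\<lambda>xs. \<Sum>x\<leftarrow>xs. g x)
      = (\<Sum>x\<in>set_pmf p. pmf p x * measure_pmf.expectation ?q (\<lambda>xs. g x + (\<Sum>y\<leftarrow>xs. g y)))"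
    using fin finite_set_replicate_pmf[OF fin]
    by (simp only:) (subst pmf_expectation_bind[of "set_pmf p"], auto)
  \<comment> \<open>The expectation over the tail does not depend on \<open>x\<close>, so it factors
    out; the remaining weights add up to 1.\<close>
  also have "\<dots> = (\<Sum>x\<in>set_pmf p. pmf p x * g x)
      + (\<Sum>x\<in>set_pmf p. pmf p x) * (real k * measure_pmf.expectation p g)"
    by (simp add: Suc.IH Bochner_Integration.integral_add[OF int int] algebra_simps sum.distrib
        sum_distrib_left del: sum_list_mult_const)
  also have "\<dots> = real (Suc k) * measure_pmf.expectation p g"
    using fin by (simp add: sum_pmf_eq_1 integral_measure_pmf_real[OF fin] algebra_simps)
  finally show ?case .
qed simp

text \<open>Fixing all points below \<open>i\<close> leaves only \<open>{i..n}\<close> to be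
  permuted, which turns the event into a set of known cardinality.\<close>

lemma permutes_fixing_prefix:
  fixes i n :: nat
  assumes "1 \<le> i"
  shows "{\<pi>. \<pi> permutes {1..n}} \<inter> {\<pi>. \<forall>t\<in>{1..<i}. \<pi> t = t} = {\<pi>. \<pi> permutes {i..n}}"
proof -
  have "\<pi> permutes {i..n}" if "\<pi> permutes {1..n}" "\<forall>t\<in>{1..<i}. \<pi> t = t" for \<pi>
    using that by (intro permutes_superset[OF that(1)]) auto
  moreover have "\<pi> permutes {1..n} \<and> (\<forall>t\<in>{1..<i}. \<pi> t = t)" if "\<pi> permutes {i..n}" for \<pi>
    using assms permutes_subset[OF that, of "{1..n}"] permutes_not_in[OF that] by auto
  ultimately show ?thesis by blast
qed

lemma expectation_card_fixed_prefixes: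
  "measure_pmf.expectation (pmf_of_set {\<pi>. \<pi> permutes {1..n}}) (\<lambda>\<pi>. real (card (fixed_prefixes n \<pi>)))
     = (\<Sum>i=2..n. fact (n + 1 - i) / fact n)"
proof -
  let ?P = "{\<pi>. \<pi> permutes {1..n}}"
  let ?A = "\<lambda>i::nat. {\<pi>. \<forall>t\<in>{1..<i}. \<pi> t = (t::nat)}"
  have fin: "finite ?P" by (rule finite_permutations) simp
  have ne: "?P \<noteq> {}" using permutes_id by blast
  have c: "card ?P = fact n" by (rule card_permutations) auto
  \<comment> \<open>As a sum of indicators, the cardinality has an expectation that is a sum of
    probabilities, each found by counting.\<close>
  have "real (card (fixed_prefixes n \<pi>)) = (\<Sum>i=2..n. indicator (?A i) \<pi>)" for \<pi>
  proof -
    have "(\<Sum>i=2..n. indicator (?A i) \<pi> :: real)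
        = (\<Sum>i\<in>{2..n}. if \<forall>t\<in>{1..<i}. \<pi> t = t then 1 else 0)"
      by (intro sum.cong) (auto simp: indicator_def)
    then show ?thesis by (simp add: fixed_prefixes_def sum.If_cases Int_def)
  qed
  then have "measure_pmf.expectation (pmf_of_set ?P) (\<lambda>\<pi>. real (card (fixed_prefixes n \<pi>)))
      = (\<Sum>i=2..n. measure_pmf.prob (pmf_of_set ?P) (?A i))"
    by (simp add: Bochner_Integration.integral_sum measure_pmf.emeasure_eq_measure)
  also have "\<dots> = (\<Sum>i=2..n. fact (n + 1 - i) / fact n)"
  proof (intro sum.cong refl)
    fix i assume "i \<in> {2..n}"
    then have "card (?P \<inter> ?A i) = fact (n + 1 - i)"
      by (subst permutes_fixing_prefix) (auto intro!: card_permutations)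
    then show "measure_pmf.prob (pmf_of_set ?P) (?A i) = fact (n + 1 - i) / fact n"
      unfolding measure_pmf_of_set[OF ne fin] c by simp
  qed
  finally show ?thesis .
qed

lemma sum_fact_le: "(\<Sum>m=1..n. fact m) \<le> (2 * fact n :: real)"
proof (induction n)
  case (Suc n)
  \<comment> \<open>The new term \<open>fact (Suc n)\<close> dominates the bound
    \<open>2 * fact n\<close> on the earlier ones. This fails for \<open>n = 0\<close>, where the
    sum is just 1.\<close>
  have "(2 * fact n :: real) \<le> fact (Suc n)" if "n \<noteq> 0"
    using that by (simp add: mult_right_mono)
  moreover have "(\<Sum>m=1..Suc n. fact m :: real) = (\<Sum>m=1..n. fact m) + fact (Suc n)"
    by simp
  ultimately show ?case using Suc by (cases "n = 0") (simp, linarith)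
qed simp

lemma expectation_card_fixed_prefixes_le:
  assumes "n \<ge> 1"
  shows "measure_pmf.expectation (pmf_of_set {\<pi>. \<pi> permutes {1..n}})
           (\<lambda>\<pi>. real (card (fixed_prefixes n \<pi>))) \<le> 2 / real n"
proof -
  \<comment> \<open>Since \<open>i\<close> starts at 2, the largest factorial is that of
    \<open>n - 1\<close>; dividing it by \<open>fact n\<close> yields the factor
    \<open>1 / n\<close>.\<close>
  have "(\<Sum>i=2..n. fact (n + 1 - i) :: real) = (\<Sum>m=1..n-1. fact m)"
    by (rule sum.reindex_bij_witness[of _ "\<lambda>m. n + 1 - m" "\<lambda>i. n + 1 - i"]) auto
  also have "\<dots> \<le> 2 * fact (n - 1)" by (rule sum_fact_le)
  finally have "(\<Sum>i=2..n. fact (n + 1 - i) / fact n) \<le> (2 * fact (n - 1) / fact n :: real)"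
    unfolding sum_divide_distrib[symmetric] by (simp add: divide_right_mono)
  also have "\<dots> = 2 / real n"
    using assms by (simp add: fact_reduce)
  finally show ?thesis by (simp only: expectation_card_fixed_prefixes)
qed

theorem theorem5:
  fixes n k :: nat
  assumes "n \<ge> 1"
  shows "expected_max_effective_row n k \<le> 1 + 2 * real k / real n \<and>
         (n \<ge> 2 * k \<longrightarrow> expected_max_effective_row n k \<le> 2)"
proof -
  let ?p = "pmf_of_set {\<pi>. \<pi> permutes {1..n}}"
  let ?q = "random_perm_seq n k"
  let ?g = "\<lambda>\<pi>. real (card (fixed_prefixes n \<pi>))"
  have "finite {\<pi>. \<pi> permutes {1..n}}" by (rule finite_permutations) simp
  then have fin: "finite (set_pmf ?p)"
    using permutes_id by (subst set_pmf_of_set) blast+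
  have int: "integrable (measure_pmf ?q) f" for f :: "_ \<Rightarrow> real"
    unfolding random_perm_seq_def
    using finite_set_replicate_pmf[OF fin] by (rule integrable_measure_pmf_finite)
  have "real (max_effective_row n G) \<le> 1 + (\<Sum>\<pi>\<leftarrow>G. ?g \<pi>)" for G
  proof -
    have "(\<Sum>\<pi>\<leftarrow>G. ?g \<pi>) = real (\<Sum>\<pi>\<leftarrow>G. card (fixed_prefixes n \<pi>))"
      by (induction G) auto
    then show ?thesis using max_effective_row_le_sum_list[of n G] by linarith
  qed
  then have "expected_max_effective_row n k
      \<le> measure_pmf.expectation ?q (\<lambda>G. 1 + (\<Sum>\<pi>\<leftarrow>G. ?g \<pi>))"
    unfolding expected_max_effective_row_def by (intro integral_mono int)
  also have "\<dots> = 1 + measure_pmf.expectation ?q (\<lambda>G. \<Sum>\<pi>\<leftarrow>G. ?g \<pi>)"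
    by (subst Bochner_Integration.integral_add[OF int int]) simp
  \<comment> \<open>All \<open>k\<close> members have the same uniform distribution, so one
    expectation is multiplied by \<open>k\<close>.\<close>
  also have "\<dots> = 1 + real k * measure_pmf.expectation ?p ?g"
    unfolding random_perm_seq_def expectation_sum_list_replicate_pmf[OF fin] ..
  also have "\<dots> \<le> 1 + real k * (2 / real n)"
    using expectation_card_fixed_prefixes_le[OF assms] by (intro add_left_mono mult_left_mono) auto
  finally have bound: "expected_max_effective_row n k \<le> 1 + 2 * real k / real n"
    by (simp add: mult.commute)
  moreover have "2 * real k / real n \<le> 1" if "n \<ge> 2 * k"
    using that assms by (simp add: divide_le_eq_1)
  ultimately show ?thesis by fastforce
qed

end
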